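(* Let $p$ be a prime and let $a\in\mathbb{Q}_p$ with $|a|_p=1$. Let $\Phi_n:(x_n,y_n)\mapsto(x_{n+1},y_{n+1})$ be the rational map of the plane (the same for every time step $n$) given by $$x_{n+1}=x_n+\frac{a}{x_n^2}-y_n,\qquad y_{n+1}=x_n .$$ Then the mapping $\Phi_n$ has almost good reduction modulo $\mathfrak{p}=p\mathbb{Z}_p$ on the domain $\mathcal{D}:=\{(x,y)\in\mathbb{Z}_p^2 \mid x\neq 0\}$.
   Context: Reduction. $|\cdot|_p$ is the $p$-adic norm on $\mathbb{Q}_p$, $\mathbb{Z}_p$ the ring of $p$-adic integers, and $\mathfrak{p}=p\mathbb{Z}_p$ its maximal ideal. For $x\in\mathbb{Z}_p$, $\tilde{x}\in\mathbb{Z}_p/\mathfrak{p}\cong\mathbb{F}_p$ is its residue class; for $x\in\mathbb{Q}_p\setminus\mathbb{Z}_p$ put $\tilde{x}=\infty$, so $\tilde{x}\in\mathbb{P}\mathbb{F}_p=\mathbb{F}_p\cup\{\infty\}$. For a pair, reduction is taken componentwise. Reduction of maps. Let $\phi(x,y)=(f(x,y),g(x,y))$ with $f,g\in\mathbb{Q}_p(x,y)$. Multiplying the numerators and denominators by suitable powers of $p$, write each of $f,g$ in "minimal form", i.e. with all coefficients in $\mathbb{Z}_p$ and at least one coefficient in $\mathbb{Z}_p^\times$. If neither denominator of the minimal forms reduces to zero modulo $\mathfrak{p}$, define $\tilde{\phi}=(\tilde{f},\tilde{g})\in(\mathbb{F}_p(x,y))^2$ by reducing all coefficients modulo $\mathfrak{p}$.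 Almost good reduction. Let $(\phi_n)$ be a (possibly non-autonomous) family of rational maps of the plane over $\mathbb{Q}_p$, and let $\mathcal{D}^{(n)}\subseteq\mathbb{Z}_p^2\cap\phi_n^{-1}(\mathbb{Q}_p^2)$ (written $\mathcal{D}$ if independent of $n$). For $m>0$ put $\phi_n^m:=(\phi_{n+m-1}\circ\phi_{n+m-2}\circ\cdots\circ\phi_n)|_{\mathcal{D}^{(n)}}$, where the composition is regarded as a pair of (simplified) rational functions in $(x,y)$, and $\widetilde{\phi_n^m}$ denotes the reduction of this composed rational map. The map $\phi_n$ has almost good reduction modulo $\mathfrak{p}$ on $\mathcal{D}^{(n)}$ if for every time step $n$ and every $\mathrm{p}=(x,y)\in\mathcal{D}^{(n)}$ there exists a positive integer $m=m_{\mathrm{p};n}$ such that $$\widetilde{\phi_n^{m}(x,y)}=\widetilde{\phi_n^{m}}(\tilde{x},\tilde{y}),$$ where in particular the right-hand side is required to be well-defined (the reduced rational map is defined at the point $(\tilde{x},\tilde{y})\in\mathbb{F}_p^2$). *)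

theory Defs
  imports
    Complex_Main
    "HOL-Computational_Algebra.Fraction_Field"
    "HOL-Computational_Algebra.Polynomial"
    "Berlekamp_Zassenhaus.Finite_Field"
begin

section \<open>The $p$-adic numbers\<close>

text \<open>
  The prime is the cardinality of a type \<open>'p\<close> of class \<open>prime_card\<close>, so a statement with a free
  type variable \<open>'p\<close> is a statement about every prime.
  \<open>'p padic_int\<close> is the inverse limit of the rings of integers modulo $p^n$: a $p$-adic integer is the sequence
  of its representatives in $[0, p^n)$.
\<close>

abbreviation pr :: "'p::prime_card itself \<Rightarrow> int" where
  "pr T \<equiv> int CARD('p)"

typedef (overloaded) ('p::prime_card) padic_int =
  "{s :: nat \<Rightarrow> int. \<forall>n. s (Suc n) mod pr TYPE('p) ^ n = s n}"
  by (rule exI[of _ "\<lambda>_. 0"]) simp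

setup_lifting type_definition_padic_int

lemma pr_gt_1: "pr TYPE('p::prime_card) > 1"
  using prime_card[where 'a='p] prime_gt_1_nat by auto

lemma prime_pr: "prime (pr TYPE('p::prime_card))"
  using prime_card[where 'a='p] by simp

lemma mod_pow_Suc: "(a::int) mod q ^ Suc n mod q ^ n = a mod q ^ n"
  by (simp add: mod_mod_cancel)

lemma padic_mod_self:
  assumes "\<forall>n. s (Suc n) mod pr TYPE('p::prime_card) ^ n = s n"
  shows "s n mod pr TYPE('p) ^ n = s n"
  by (metis assms mod_mod_trivial)

lemma padic_cong_Suc:
  assumes "\<And>n. s (Suc n) mod pr TYPE('p::prime_card) ^ n = s n"
  shows "[s (Suc n) = s n] (mod pr TYPE('p) ^ n)"
  unfolding cong_def using padic_mod_self[of s] assms by metis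

lemma padic_lift_mod:
  assumes "[f (Suc n) = f n] (mod pr TYPE('p::prime_card) ^ n)"
  shows "f (Suc n) mod pr TYPE('p) ^ Suc n mod pr TYPE('p) ^ n = f n mod pr TYPE('p) ^ n"
  unfolding mod_pow_Suc using assms unfolding cong_def .

instantiation padic_int :: (prime_card) comm_ring_1
begin

lift_definition zero_padic_int :: "'a padic_int" is "\<lambda>n. 0" by simp
lift_definition one_padic_int :: "'a padic_int" is "\<lambda>n. 1 mod pr TYPE('a) ^ n"
  by (rule padic_lift_mod) (rule cong_refl)
lift_definition plus_padic_int :: "'a padic_int \<Rightarrow> 'a padic_int \<Rightarrow> 'a padic_int"
  is "\<lambda>s t n. (s n + t n) mod pr TYPE('a) ^ n"
  by (intro padic_lift_mod cong_add padic_cong_Suc)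
lift_definition times_padic_int :: "'a padic_int \<Rightarrow> 'a padic_int \<Rightarrow> 'a padic_int"
  is "\<lambda>s t n. (s n * t n) mod pr TYPE('a) ^ n"
  by (intro padic_lift_mod cong_mult padic_cong_Suc)
lift_definition minus_padic_int :: "'a padic_int \<Rightarrow> 'a padic_int \<Rightarrow> 'a padic_int"
  is "\<lambda>s t n. (s n - t n) mod pr TYPE('a) ^ n"
  by (intro padic_lift_mod cong_diff padic_cong_Suc)
lift_definition uminus_padic_int :: "'a padic_int \<Rightarrow> 'a padic_int"
  is "\<lambda>s n. (- s n) mod pr TYPE('a) ^ n"
  by (intro padic_lift_mod cong_minus_minus_iff[THEN iffD2] padic_cong_Suc)

instance
proof
  fix a b c :: "'a padic_int"
  show "a + b + c = a + (b + c)" by transfer (simp add: mod_simps add.assoc)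
  show "a + b = b + a" by transfer (simp add: add.commute)
  show "0 + a = a" by transfer (simp add: padic_mod_self)
  show "- a + a = 0" by transfer (simp add: mod_simps)
  show "a - b = a + - b" by transfer (simp add: mod_simps)
  show "a * b * c = a * (b * c)" by transfer (simp add: mod_simps mult.assoc)
  show "a * b = b * a" by transfer (simp add: mult.commute)
  show "1 * a = a" by transfer (simp add: mod_simps padic_mod_self)
  show "(a + b) * c = a * c + b * c" by transfer (simp add: mod_simps distrib_right)
  show "(0 :: 'a padic_int) \<noteq> 1"
  proof transfer
    have "(1::int) mod pr TYPE('a) ^ 1 = 1" using pr_gt_1[where 'p='a] by simp
    thus "(\<lambda>n. 0) \<noteq> (\<lambda>n. 1 mod pr TYPE('a) ^ n)"
      by (metis zero_neq_one)
  qed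
qed

end

lemma padic_coherent:
  assumes "\<forall>n. s (Suc n) mod pr TYPE('p::prime_card) ^ n = s n" "k \<le> n"
  shows "s k = s n mod pr TYPE('p) ^ k"
  using assms(2)
proof (induction n rule: dec_induct)
  case base
  show ?case using padic_mod_self[OF assms(1)] by metis
next
  case (step n)
  have "s (Suc n) mod pr TYPE('p) ^ k = s (Suc n) mod pr TYPE('p) ^ n mod pr TYPE('p) ^ k"
    using step(1) by (simp add: mod_mod_cancel le_imp_power_dvd)
  also have "\<dots> = s k" using step assms(1) by metis
  finally show ?case ..
qed

lemma prime_power_not_dvd_mult:
  fixes q :: int
  assumes "prime q" "\<not> q ^ Suc k dvd a" "\<not> q ^ Suc l dvd b"
  shows "\<not> q ^ Suc (k + l) dvd a * b"
proof -
  from assms have nz: "a \<noteq> 0" "b \<noteq> 0" and "\<not> is_unit q" "q \<noteq> 0"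
    using not_prime_unit by auto
  with assms have "multiplicity q a < Suc k" "multiplicity q b < Suc l"
    by (meson linorder_not_less multiplicity_dvd')+
  moreover have "multiplicity q (a * b) = multiplicity q a + multiplicity q b"
    using assms(1) nz by (intro prime_elem_multiplicity_mult_distrib prime_imp_prime_elem)
  ultimately show ?thesis
    using nz \<open>\<not> is_unit q\<close> multiplicity_geI[of "a * b" q "Suc (k + l)"] by force
qed

text \<open>The coordinate of index $n$ vanishes iff $x \in p^n \mathbf{Z}_p$.\<close>

lift_definition padic_coord :: "'p::prime_card padic_int \<Rightarrow> nat \<Rightarrow> int" is "\<lambda>s. s" .

lemma padic_coord_nonzero_mono:
  assumes "padic_coord x k \<noteq> 0" "k \<le> n"
  shows "padic_coord x n \<noteq> 0"
  using assms by transfer (metis padic_coherent mod_0)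

lemma padic_coord_mult_nonzero:
  fixes x y :: "'p::prime_card padic_int"
  assumes "padic_coord x (Suc k) \<noteq> 0" "padic_coord y (Suc l) \<noteq> 0"
  shows "padic_coord (x * y) (Suc (k + l)) \<noteq> 0"
  using assms
proof transfer
  fix k l :: nat and s t :: "nat \<Rightarrow> int"
  let ?p = "pr TYPE('p)"
  assume s: "\<forall>n. s (Suc n) mod ?p ^ n = s n" and t: "\<forall>n. t (Suc n) mod ?p ^ n = t n"
    and nz: "s (Suc k) \<noteq> 0" "t (Suc l) \<noteq> 0"
  let ?N = "Suc (k + l)"
  have "s (Suc k) = s ?N mod ?p ^ Suc k" "t (Suc l) = t ?N mod ?p ^ Suc l"
    by (rule padic_coherent[OF s], simp, rule padic_coherent[OF t], simp)
  with nz have "\<not> ?p ^ Suc k dvd s ?N" "\<not> ?p ^ Suc l dvd t ?N"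
    by (metis dvd_imp_mod_0)+
  from prime_power_not_dvd_mult[OF prime_pr this]
  show "s ?N * t ?N mod ?p ^ ?N \<noteq> 0"
    by (simp add: mod_eq_0_iff_dvd)
qed

lemma padic_coord_0 [simp]: "padic_coord x 0 = 0"
  by transfer (metis mod_by_1 mod_mod_trivial power_0 mod_self padic_mod_self)

lemma padic_nonzero_iff: "x \<noteq> 0 \<longleftrightarrow> (\<exists>n. padic_coord x (Suc n) \<noteq> 0)"
proof -
  have "x = 0 \<longleftrightarrow> (\<forall>n. padic_coord x n = 0)" by transfer auto
  thus ?thesis by (metis padic_coord_0 not0_implies_Suc)
qed

instance padic_int :: (prime_card) idom
  by standard (metis padic_nonzero_iff padic_coord_mult_nonzero)

type_synonym 'p padic = "'p padic_int fract"

text \<open>The exponent of the largest power of $p$ dividing \<open>x\<close>; only meaningful for \<open>x \<noteq> 0\<close>.\<close>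

definition padic_int_val :: "'p::prime_card padic_int \<Rightarrow> nat" where
  "padic_int_val x = (GREATEST n. of_nat CARD('p) ^ n dvd x)"

lemma padic_coord_1 [simp]: "padic_coord (1 :: 'p::prime_card padic_int) n = 1 mod pr TYPE('p) ^ n"
  by transfer simp

lemma padic_coord_add:
  "padic_coord (x + y :: 'p::prime_card padic_int) n
     = (padic_coord x n + padic_coord y n) mod pr TYPE('p) ^ n"
  by transfer simp

lemma padic_coord_zero [simp]: "padic_coord 0 n = 0"
  by transfer simp

lemma padic_coord_mult:
  "padic_coord (x * y :: 'p::prime_card padic_int) n
     = padic_coord x n * padic_coord y n mod pr TYPE('p) ^ n"
  by transfer simp

lemma padic_coord_of_nat:
  "padic_coord (of_nat k :: 'p::prime_card padic_int) n = int k mod pr TYPE('p) ^ n"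
  by (induction k) (simp_all add: padic_coord_add mod_simps)

lemma padic_coord_coherent:
  "k \<le> n \<Longrightarrow> padic_coord (x :: 'p::prime_card padic_int) k = padic_coord x n mod pr TYPE('p) ^ k"
  by transfer (rule padic_coherent)

lemma padic_coord_pow_mult:
  "padic_coord (of_nat CARD('p) ^ n * y :: 'p::prime_card padic_int) k
     = (pr TYPE('p) ^ n * padic_coord y k) mod pr TYPE('p) ^ k"
proof -
  have "padic_coord (of_nat (CARD('p) ^ n) * y :: 'p padic_int) k
      = (int (CARD('p) ^ n) * padic_coord y k) mod pr TYPE('p) ^ k"
    unfolding padic_coord_mult padic_coord_of_nat by (rule mod_mult_left_eq)
  thus ?thesis by simp
qed

lemma padic_pow_dvd_iff:
  fixes x :: "'p::prime_card padic_int"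
  shows "of_nat CARD('p) ^ n dvd x \<longleftrightarrow> padic_coord x n = 0"
proof
  assume "of_nat CARD('p) ^ n dvd x"
  then obtain y where "x = of_nat CARD('p) ^ n * y" by (auto simp: dvd_def)
  thus "padic_coord x n = 0"
    by (simp add: padic_coord_pow_mult)
next
  let ?p = "pr TYPE('p)"
  assume x0: "padic_coord x n = 0"
  define s where "s = (\<lambda>k. padic_coord x (k + n) div ?p ^ n)"
  have p0: "?p > 0" using pr_gt_1[where 'p='p] by simp
  have div: "?p ^ n dvd padic_coord x (k + n)" for k
    using padic_coord_coherent[of n "k + n" x] x0 by (simp add: dvd_eq_mod_eq_0)
  have s: "s k * ?p ^ n = padic_coord x (k + n)" for k
    using div by (simp add: s_def)
  have coh: "s (Suc k) mod ?p ^ k = s k" for k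
  proof -
    have "s k * ?p ^ n = s (Suc k) * ?p ^ n mod ?p ^ (k + n)"
      using padic_coord_coherent[of "k + n" "Suc k + n" x] by (simp only: s)
    also have "\<dots> = (s (Suc k) mod ?p ^ k) * ?p ^ n"
      by (simp add: power_add)
    finally show ?thesis using p0 by simp
  qed
  define y :: "'p padic_int" where "y = Abs_padic_int s"
  have y: "padic_coord y = s"
    using coh by (simp add: y_def padic_coord.rep_eq Abs_padic_int_inverse)
  have "padic_coord x k = padic_coord (of_nat CARD('p) ^ n * y) k" for k
  proof -
    have "padic_coord x k = (s k * ?p ^ n) mod ?p ^ k"
      by (simp only: s) (rule padic_coord_coherent, simp)
    thus ?thesis
      by (simp only: padic_coord_pow_mult y mult.commute[of "s k"])
  qed
  hence "padic_coord x = padic_coord (of_nat CARD('p) ^ n * y)" by blast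
  hence "x = of_nat CARD('p) ^ n * y"
    by (simp only: padic_coord.rep_eq Rep_padic_int_inject)
  thus "of_nat CARD('p) ^ n dvd x" by simp
qed

lemma padic_int_val_eqI:
  fixes x :: "'p::prime_card padic_int"
  assumes "padic_coord x n = 0" "padic_coord x (Suc n) \<noteq> 0"
  shows "padic_int_val x = n"
  unfolding padic_int_val_def
proof (rule Greatest_equality)
  show "of_nat CARD('p) ^ n dvd x" using assms(1) by (simp only: padic_pow_dvd_iff)
next
  fix m
  assume "of_nat CARD('p) ^ m dvd x"
  hence "padic_coord x m = 0" by (simp only: padic_pow_dvd_iff)
  thus "m \<le> n"
    using assms(2) padic_coord_nonzero_mono[of x "Suc n" m] by (meson not_less_eq_eq)
qed

lemma padic_coord_val:
  assumes "x \<noteq> 0"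
  shows "padic_coord x (padic_int_val x) = 0" "padic_coord x (Suc (padic_int_val x)) \<noteq> 0"
proof -
  define n where "n = (LEAST n. padic_coord x (Suc n) \<noteq> 0)"
  from assms obtain k where "padic_coord x (Suc k) \<noteq> 0" using padic_nonzero_iff by blast
  hence n: "padic_coord x (Suc n) \<noteq> 0" unfolding n_def by (rule LeastI)
  moreover have "padic_coord x n = 0"
    using not_less_Least[of _ "\<lambda>n. padic_coord x (Suc n) \<noteq> 0"]
    by (cases n) (auto simp: n_def[symmetric])
  ultimately show "padic_coord x (padic_int_val x) = 0"
    "padic_coord x (Suc (padic_int_val x)) \<noteq> 0"
    using padic_int_val_eqI[of x n] by auto
qed

lemma padic_int_val_mult:
  fixes x y :: "'p::prime_card padic_int"
  assumes "x \<noteq> 0" "y \<noteq> 0"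
  shows "padic_int_val (x * y) = padic_int_val x + padic_int_val y"
proof (rule padic_int_val_eqI)
  have "of_nat CARD('p) ^ padic_int_val x dvd x" "of_nat CARD('p) ^ padic_int_val y dvd y"
    using padic_coord_val(1) assms by (simp_all only: padic_pow_dvd_iff not_False_eq_True)
  hence "of_nat CARD('p) ^ (padic_int_val x + padic_int_val y) dvd x * y"
    unfolding power_add by (rule mult_dvd_mono)
  thus "padic_coord (x * y) (padic_int_val x + padic_int_val y) = 0"
    by (simp only: padic_pow_dvd_iff)
  show "padic_coord (x * y) (Suc (padic_int_val x + padic_int_val y)) \<noteq> 0"
    using assms by (intro padic_coord_mult_nonzero padic_coord_val)
qed

definition padic_norm :: "'p::prime_card padic \<Rightarrow> real" where
  "padic_norm x =
     (if x = 0 then 0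
      else (THE r. \<exists>a b. a \<noteq> 0 \<and> b \<noteq> 0 \<and> x = Fract a b \<and>
                r = real CARD('p) powi (int (padic_int_val b) - int (padic_int_val a))))"

lemma padic_norm_Fract:
  assumes "a \<noteq> 0" "b \<noteq> 0"
  shows "padic_norm (Fract a b :: 'p::prime_card padic)
           = real CARD('p) powi (int (padic_int_val b) - int (padic_int_val a))"
proof -
  let ?r = "\<lambda>a b. real CARD('p) powi (int (padic_int_val b) - int (padic_int_val a))"
  let ?x = "Fract a b"
  have eq: "?r c d = ?r a b" if "c \<noteq> 0" "d \<noteq> 0" "?x = Fract c d" for c d
  proof -
    have "a * d = c * b" using assms that by (simp add: eq_fract)
    hence "padic_int_val a + padic_int_val d = padic_int_val c + padic_int_val b"
      using assms that by (metis padic_int_val_mult)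
    hence "int (padic_int_val d) - int (padic_int_val c) = int (padic_int_val b) - int (padic_int_val a)"
      by linarith
    thus ?thesis by (simp only:)
  qed
  have "?x \<noteq> 0" using assms by (simp add: fract_expand eq_fract)
  moreover have "(THE r. \<exists>c d. c \<noteq> 0 \<and> d \<noteq> 0 \<and> ?x = Fract c d \<and> r = ?r c d) = ?r a b"
  proof (rule the_equality)
    show "\<exists>c d. c \<noteq> 0 \<and> d \<noteq> 0 \<and> ?x = Fract c d \<and> ?r a b = ?r c d" using assms by blast
  next
    fix r
    assume "\<exists>c d. c \<noteq> 0 \<and> d \<noteq> 0 \<and> ?x = Fract c d \<and> r = ?r c d"
    then obtain c d where "c \<noteq> 0" "d \<noteq> 0" "?x = Fract c d" "r = ?r c d" by blast
    thus "r = ?r a b" using eq by simp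
  qed
  ultimately show ?thesis unfolding padic_norm_def by (simp only: if_False)
qed

definition of_padic_int :: "'p::prime_card padic_int \<Rightarrow> 'p padic" where
  "of_padic_int z = Fract z 1"

definition padic_ints :: "'p::prime_card padic set" where
  "padic_ints = range of_padic_int"

text \<open>The residue map $\mathbf{Z}_p \to \mathbf{F}_p$.\<close>

definition padic_residue :: "'p::prime_card padic_int \<Rightarrow> 'p mod_ring" where
  "padic_residue z = of_int (padic_coord z 1)"

datatype 'a proj_line = Finite 'a | Infinity

definition padic_reduce :: "'p::prime_card padic \<Rightarrow> 'p mod_ring proj_line" where
  "padic_reduce x =
     (if x \<in> padic_ints then Finite (padic_residue (the_inv of_padic_int x)) else Infinity)"

lemma inj_of_padic_int: "inj of_padic_int"
  by (auto simp: inj_def of_padic_int_def eq_fract)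

lemma padic_reduce_of_padic_int [simp]: "padic_reduce (of_padic_int z) = Finite (padic_residue z)"
  by (simp add: padic_reduce_def padic_ints_def inj_of_padic_int the_inv_f_f)

lemma padic_int_eqI:
  assumes "\<And>n. padic_coord x n = padic_coord y n"
  shows "x = y"
  using assms by transfer auto

lemma padic_coord_Abs:
  assumes "\<And>n. s (Suc n) mod pr TYPE('p::prime_card) ^ n = s n"
  shows "padic_coord (Abs_padic_int s :: 'p padic_int) = s"
  using assms by (simp add: padic_coord.rep_eq Abs_padic_int_inverse)

lemma padic_int_unitI:
  fixes x :: "'p::prime_card padic_int"
  assumes "padic_coord x 1 \<noteq> 0"
  shows "x dvd 1"
proof -
  let ?p = "pr TYPE('p)"
  have p1: "?p > 1" by (rule pr_gt_1)
  have cop: "coprime (padic_coord x n) (?p ^ n)" for n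
  proof (cases n)
    case (Suc m)
    have "padic_coord x 1 = padic_coord x n mod ?p"
      using padic_coord_coherent[of 1 n x] Suc by simp
    with assms have "\<not> ?p dvd padic_coord x n" by auto
    hence "coprime ?p (padic_coord x n)" by (rule prime_imp_coprime[OF prime_pr])
    thus ?thesis by (simp add: coprime_commute)
  qed simp
  have "\<exists>t. [padic_coord x n * t = 1] (mod ?p ^ n)" for n
    using cop cong_solve_coprime_int by blast
  then obtain t where t: "[padic_coord x n * t n = 1] (mod ?p ^ n)" for n by metis
  define s where "s n = t n mod ?p ^ n" for n
  have coh: "s (Suc n) mod ?p ^ n = s n" for n
  proof -
    have "[padic_coord x (Suc n) * t (Suc n) = 1] (mod ?p ^ n)"
      using t[of "Suc n"] by (rule cong_dvd_modulus) simp
    moreover have "[padic_coord x n = padic_coord x (Suc n)] (mod ?p ^ n)"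
      using padic_coord_coherent[of n "Suc n" x] by (simp add: cong_def)
    ultimately have "[padic_coord x n * t (Suc n) = 1] (mod ?p ^ n)"
      by (meson cong_scalar_right cong_trans)
    hence "[padic_coord x n * t (Suc n) = padic_coord x n * t n] (mod ?p ^ n)"
      using t[of n] by (meson cong_sym cong_trans)
    hence "[t (Suc n) = t n] (mod ?p ^ n)"
      using cop[of n] cong_mult_lcancel by blast
    thus ?thesis by (simp add: s_def cong_def mod_mod_cancel)
  qed
  have "x * Abs_padic_int s = 1"
  proof (rule padic_int_eqI)
    fix n
    show "padic_coord (x * Abs_padic_int s) n = padic_coord (1 :: 'p padic_int) n"
      using t[of n] by (simp add: padic_coord_mult padic_coord_Abs[OF coh] s_def cong_def mod_simps)
  qed
  thus ?thesis by (metis dvd_triv_left)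
qed

lemma padic_int_decomp:
  fixes x :: "'p::prime_card padic_int"
  assumes "x \<noteq> 0"
  obtains w where "w dvd 1" "x = of_nat CARD('p) ^ padic_int_val x * w"
proof -
  let ?p = "of_nat CARD('p) :: 'p padic_int"
  have "?p ^ padic_int_val x dvd x"
    using padic_coord_val(1)[OF assms] by (simp only: padic_pow_dvd_iff)
  then obtain w where w: "x = ?p ^ padic_int_val x * w" by (auto simp: dvd_def)
  have "padic_coord w 1 \<noteq> 0"
  proof
    assume "padic_coord w 1 = 0"
    hence "?p ^ 1 dvd w" by (simp only: padic_pow_dvd_iff)
    hence "?p ^ padic_int_val x * ?p ^ 1 dvd ?p ^ padic_int_val x * w"
      by (intro mult_dvd_mono dvd_refl)
    hence "?p ^ Suc (padic_int_val x) dvd x" by (metis w power_Suc2 power_one_right)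
    with padic_coord_val(2)[OF assms] show False by (simp only: padic_pow_dvd_iff)
  qed
  with w padic_int_unitI that show ?thesis by blast
qed

lemma padic_dvd_iff_val_le:
  fixes a b :: "'p::prime_card padic_int"
  assumes "a \<noteq> 0" "b \<noteq> 0"
  shows "b dvd a \<longleftrightarrow> padic_int_val b \<le> padic_int_val a"
proof
  assume "b dvd a"
  then obtain c where "a = b * c" by (auto simp: dvd_def)
  thus "padic_int_val b \<le> padic_int_val a" using assms padic_int_val_mult[of b c] by auto
next
  assume le: "padic_int_val b \<le> padic_int_val a"
  obtain w where "w dvd 1" and w: "b = of_nat CARD('p) ^ padic_int_val b * w"
    using padic_int_decomp[OF assms(2)] .
  obtain w' where w': "a = of_nat CARD('p) ^ padic_int_val a * w'"
    using padic_int_decomp[OF assms(1)] by metis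
  have "of_nat CARD('p) ^ padic_int_val b * w dvd of_nat CARD('p) ^ padic_int_val a * w'"
    using le \<open>w dvd 1\<close> by (intro mult_dvd_mono le_imp_power_dvd) (auto intro: dvd_trans)
  thus "b dvd a" by (metis w w')
qed

lemma padic_ints_iff_norm_le_1:
  fixes x :: "'p::prime_card padic"
  shows "x \<in> padic_ints \<longleftrightarrow> padic_norm x \<le> 1"
proof (cases x)
  case (Fract a b)
  have p1: "real CARD('p) > 1" using pr_gt_1[where 'p='p] by simp
  have mem: "x \<in> padic_ints \<longleftrightarrow> b dvd a"
    using Fract by (auto simp: padic_ints_def of_padic_int_def eq_fract dvd_def image_iff mult.commute)
  show ?thesis
  proof (cases "a = 0")
    case True
    have "padic_norm (Fract 0 b :: 'p padic) = 0" by (simp add: padic_norm_def fract_collapse)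
    thus ?thesis using True Fract mem by simp
  next
    case False
    have "padic_norm x \<le> 1 \<longleftrightarrow>
        real CARD('p) powi (int (padic_int_val b) - int (padic_int_val a)) \<le> real CARD('p) powi 0"
      using padic_norm_Fract[OF False Fract(2)] Fract(1) by simp
    also have "\<dots> \<longleftrightarrow> padic_int_val b \<le> padic_int_val a"
      using p1 power_int_le_imp_le_exp[of "real CARD('p)"] power_int_increasing[of _ 0 "real CARD('p)"]
      by fastforce
    finally show ?thesis using mem padic_dvd_iff_val_le[OF False Fract(2)] by simp
  qed
qed

lemma padic_residue_hom: "comm_ring_hom (padic_residue :: 'p::prime_card padic_int \<Rightarrow> 'p mod_ring)"
proof -
  have m: "(of_int (k mod pr TYPE('p)) :: 'p mod_ring) = of_int k" for k
    by (simp add: of_int_of_int_mod_ring) (transfer, simp)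
  show ?thesis
    by unfold_locales
      (simp_all only: padic_residue_def padic_coord_add padic_coord_mult padic_coord_zero
         padic_coord_1 power_one_right m of_int_add of_int_mult of_int_0 of_int_1)
qed

lemma padic_residue_eq_0_iff:
  fixes x :: "'p::prime_card padic_int"
  shows "padic_residue x = 0 \<longleftrightarrow> of_nat CARD('p) dvd x"
proof -
  have "padic_coord x 1 = padic_coord x 1 mod pr TYPE('p)"
    using padic_coord_coherent[of 1 1 x] by simp
  moreover have "(of_int k :: 'p mod_ring) = 0 \<longleftrightarrow> k mod pr TYPE('p) = 0" for k
    by (simp add: of_int_of_int_mod_ring) (transfer, simp)
  moreover have "of_nat CARD('p) dvd x \<longleftrightarrow> padic_coord x 1 = 0"
    using padic_pow_dvd_iff[of 1 x] by simp
  ultimately show ?thesis by (simp add: padic_residue_def)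
qed

section \<open>Rational functions of two variables\<close>

text \<open>
  In \<open>'a poly poly\<close> the inner variable is $x$ and the outer variable is $y$.
\<close>

type_synonym 'a ratfun = "'a poly poly fract"
type_synonym 'a ratmap = "'a ratfun \<times> 'a ratfun"

definition rat_const :: "'a::idom \<Rightarrow> 'a ratfun" where "rat_const c = Fract [:[:c:]:] 1"
definition rat_X :: "'a::idom ratfun" where "rat_X = Fract [:[:0, 1:]:] 1"
definition rat_Y :: "'a::idom ratfun" where "rat_Y = Fract [:0, 1:] 1"

text \<open>The polynomial obtained by applying \<open>h\<close> to all coefficients, evaluated at the given point.\<close>

definition poly2 :: "('a::zero \<Rightarrow> 'b::comm_semiring_0) \<Rightarrow> 'a poly poly \<Rightarrow> 'b \<times> 'b \<Rightarrow> 'b" where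
  "poly2 h P = (\<lambda>(u, v). poly (poly (map_poly (map_poly h) P) [:v:]) u)"

text \<open>
  The value of \<open>f\<close> at \<open>pt\<close>, along a ring homomorphism \<open>h\<close> of fields. It exists iff some representation
  of \<open>f\<close> as a fraction (equivalently, the one in lowest terms) has a denominator that does not
  vanish at \<open>pt\<close>; by \<open>rat_value_eq\<close> below it does not depend on the fraction.
\<close>

definition rat_value :: "('a::field \<Rightarrow> 'b::field) \<Rightarrow> 'a ratfun \<Rightarrow> 'b \<times> 'b \<Rightarrow> 'b option" where
  "rat_value h f pt =
     (if \<exists>P Q. f = Fract P Q \<and> poly2 h Q pt \<noteq> 0
      then Some (THE w. \<exists>P Q. f = Fract P Q \<and> poly2 h Q pt \<noteq> 0 \<and>
                              w = poly2 h P pt / poly2 h Q pt)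
      else None)"

lemma poly2_mult:
  assumes "comm_ring_hom h"
  shows "poly2 h (P * Q) pt = poly2 h P pt * poly2 h Q pt"
proof -
  interpret comm_ring_hom h by (rule assms)
  interpret m: map_poly_comm_ring_hom h ..
  interpret mm: map_poly_comm_ring_hom "map_poly h" ..
  show ?thesis by (cases pt) (simp add: poly2_def mm.hom_mult)
qed

lemma poly2_0 [simp]: "poly2 h 0 pt = 0"
  by (cases pt) (simp add: poly2_def)

lemma rat_value_eq:
  assumes h: "comm_ring_hom h" and f: "f = Fract P Q" and Q: "poly2 h Q pt \<noteq> 0"
  shows "rat_value h f pt = Some (poly2 h P pt / poly2 h Q pt)"
proof -
  have eq: "poly2 h P' pt / poly2 h Q' pt = poly2 h P pt / poly2 h Q pt"
    if "f = Fract P' Q'" and Q': "poly2 h Q' pt \<noteq> 0" for P' Q'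
  proof -
    have "Q \<noteq> 0" "Q' \<noteq> 0" using Q Q' by auto
    with that f have "P' * Q = P * Q'" by (simp add: eq_fract)
    hence "poly2 h P' pt * poly2 h Q pt = poly2 h P pt * poly2 h Q' pt"
      by (metis poly2_mult[OF h])
    thus ?thesis using Q Q' by (simp add: field_simps)
  qed
  have "(THE w. \<exists>P Q. f = Fract P Q \<and> poly2 h Q pt \<noteq> 0 \<and> w = poly2 h P pt / poly2 h Q pt)
      = poly2 h P pt / poly2 h Q pt"
  proof (rule the_equality)
    show "\<exists>P' Q'. f = Fract P' Q' \<and> poly2 h Q' pt \<noteq> 0 \<and>
            poly2 h P pt / poly2 h Q pt = poly2 h P' pt / poly2 h Q' pt"
      using f Q by blast
  next
    fix w
    assume "\<exists>P Q. f = Fract P Q \<and> poly2 h Q pt \<noteq> 0 \<and> w = poly2 h P pt / poly2 h Q pt"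
    then obtain P' Q' where "f = Fract P' Q'" "poly2 h Q' pt \<noteq> 0"
      and w: "w = poly2 h P' pt / poly2 h Q' pt" by blast
    thus "w = poly2 h P pt / poly2 h Q pt" unfolding w by (intro eq)
  qed
  moreover have "\<exists>P Q. f = Fract P Q \<and> poly2 h Q pt \<noteq> 0" using f Q by blast
  ultimately show ?thesis unfolding rat_value_def by (simp only: if_True)
qed

definition ratmap_value ::
    "('a::field \<Rightarrow> 'b::field) \<Rightarrow> 'a ratmap \<Rightarrow> 'b \<times> 'b \<Rightarrow> ('b \<times> 'b) option" where
  "ratmap_value h \<phi> pt =
     (case (rat_value h (fst \<phi>) pt, rat_value h (snd \<phi>) pt) of
        (Some u, Some v) \<Rightarrow> Some (u, v)
      | _ \<Rightarrow> None)"

text \<open>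
  Composition is evaluation at a point with coordinates in the function field. It is undefined
  (\<open>None\<close>) if a denominator of \<open>\<phi>\<close> vanishes identically on the image of \<open>\<psi>\<close>. The result is an
  element of the function field, so common factors are cancelled before it is evaluated or reduced.
\<close>

definition ratmap_comp :: "'a::field ratmap \<Rightarrow> 'a ratmap \<Rightarrow> 'a ratmap option" where
  "ratmap_comp \<phi> \<psi> = ratmap_value rat_const \<phi> \<psi>"

primrec ratmap_iter :: "(int \<Rightarrow> 'a::field ratmap) \<Rightarrow> int \<Rightarrow> nat \<Rightarrow> 'a ratmap option" where
  "ratmap_iter \<phi> n 0 = Some (rat_X, rat_Y)"
| "ratmap_iter \<phi> n (Suc m) = Option.bind (ratmap_iter \<phi> n m) (ratmap_comp (\<phi> (n + int m)))"

section \<open>Reduction of rational maps\<close>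

definition minimal_form ::
    "'p::prime_card padic ratfun \<Rightarrow> 'p padic_int poly poly \<Rightarrow> 'p padic_int poly poly \<Rightarrow> bool" where
  "minimal_form f P Q \<longleftrightarrow>
     Q \<noteq> 0 \<and>
     f = Fract (map_poly (map_poly of_padic_int) P) (map_poly (map_poly of_padic_int) Q) \<and>
     (\<exists>i j. coeff (coeff P j) i dvd 1 \<or> coeff (coeff Q j) i dvd 1)"

abbreviation residue_poly2 :: "'p::prime_card padic_int poly poly \<Rightarrow> 'p mod_ring poly poly" where
  "residue_poly2 \<equiv> map_poly (map_poly padic_residue)"

text \<open>
  By \<open>ratfun_reduce_eq\<close> and \<open>minimal_form_denom\<close> below, neither the result nor its existence depends
  on the choice of the minimal form.
\<close>

definition ratfun_reduce :: "'p::prime_card padic ratfun \<Rightarrow> 'p mod_ring ratfun option" where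
  "ratfun_reduce f =
     (if \<exists>P Q. minimal_form f P Q \<and> residue_poly2 Q \<noteq> 0
      then Some (THE r. \<exists>P Q. minimal_form f P Q \<and> residue_poly2 Q \<noteq> 0 \<and>
                              r = Fract (residue_poly2 P) (residue_poly2 Q))
      else None)"

lemma of_padic_int_hom: "inj_comm_ring_hom of_padic_int"
proof -
  interpret comm_ring_hom of_padic_int
    by unfold_locales (auto simp: of_padic_int_def fract_collapse)
  show ?thesis
    by unfold_locales (auto simp: of_padic_int_def fract_expand eq_fract)
qed

lemma minimal_form_cross:
  assumes "minimal_form f P Q" "minimal_form f P' Q'"
  shows "residue_poly2 P * residue_poly2 Q' = residue_poly2 P' * residue_poly2 Q"
proof -
  interpret inj_comm_ring_hom of_padic_int by (rule of_padic_int_hom)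
  interpret m: map_poly_inj_comm_ring_hom of_padic_int ..
  interpret mm: map_poly_inj_comm_ring_hom "map_poly of_padic_int" ..
  interpret r: comm_ring_hom padic_residue by (rule padic_residue_hom)
  interpret rm: map_poly_comm_ring_hom padic_residue ..
  interpret rmm: map_poly_comm_ring_hom "map_poly padic_residue" ..
  let ?e = "map_poly (map_poly of_padic_int)"
  have "Q \<noteq> 0" "Q' \<noteq> 0" "Fract (?e P) (?e Q) = Fract (?e P') (?e Q')"
    using assms by (auto simp: minimal_form_def)
  hence "?e P * ?e Q' = ?e P' * ?e Q" by (simp add: eq_fract)
  hence "?e (P * Q') = ?e (P' * Q)" by (simp add: mm.hom_mult)
  hence "P * Q' = P' * Q" by (rule mm.injectivity)
  thus ?thesis by (metis rmm.hom_mult)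
qed

lemma minimal_form_denom:
  assumes "minimal_form f P Q" "minimal_form f P' Q'" "residue_poly2 Q \<noteq> 0"
  shows "residue_poly2 Q' \<noteq> 0"
proof
  assume Q': "residue_poly2 Q' = 0"
  have "residue_poly2 P' = 0" using minimal_form_cross[OF assms(1,2)] Q' assms(3) by simp
  with Q' have "padic_residue (coeff (coeff P' j) i) = 0" "padic_residue (coeff (coeff Q' j) i) = 0" for i j
  proof -
    interpret r: comm_ring_hom padic_residue by (rule padic_residue_hom)
    have c: "coeff (coeff (residue_poly2 R) j) i = padic_residue (coeff (coeff R j) i)" for R
      by (simp add: coeff_map_poly)
    show "padic_residue (coeff (coeff P' j) i) = 0" "padic_residue (coeff (coeff Q' j) i) = 0"
      using c[of P'] c[of Q'] Q' \<open>residue_poly2 P' = 0\<close> by simp_all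
  qed
  moreover have "padic_residue z \<noteq> 0" if "z dvd 1" for z
  proof -
    interpret r: comm_ring_hom padic_residue by (rule padic_residue_hom)
    from that obtain w where "1 = z * w" by (auto simp: dvd_def)
    hence "padic_residue z * padic_residue w = 1" by (metis r.hom_mult r.hom_one)
    thus ?thesis by auto
  qed
  ultimately show False using assms(2) unfolding minimal_form_def by metis
qed

lemma ratfun_reduce_eq:
  assumes "minimal_form f P Q" "residue_poly2 Q \<noteq> 0"
  shows "ratfun_reduce f = Some (Fract (residue_poly2 P) (residue_poly2 Q))"
proof -
  have "(THE r. \<exists>P Q. minimal_form f P Q \<and> residue_poly2 Q \<noteq> 0 \<and>
               r = Fract (residue_poly2 P) (residue_poly2 Q))
      = Fract (residue_poly2 P) (residue_poly2 Q)"
  proof (rule the_equality)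
    fix r
    assume "\<exists>P Q. minimal_form f P Q \<and> residue_poly2 Q \<noteq> 0 \<and>
               r = Fract (residue_poly2 P) (residue_poly2 Q)"
    then obtain P' Q' where 1: "minimal_form f P' Q'" "residue_poly2 Q' \<noteq> 0"
      and r: "r = Fract (residue_poly2 P') (residue_poly2 Q')" by blast
    show "r = Fract (residue_poly2 P) (residue_poly2 Q)"
      unfolding r using minimal_form_cross[OF 1(1) assms(1)] 1(2) assms(2) by (simp add: eq_fract)
  qed (use assms in blast)
  moreover have "\<exists>P Q. minimal_form f P Q \<and> residue_poly2 Q \<noteq> 0" using assms by blast
  ultimately show ?thesis unfolding ratfun_reduce_def by (simp only: if_True)
qed

definition ratmap_reduce :: "'p::prime_card padic ratmap \<Rightarrow> 'p mod_ring ratmap option" where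
  "ratmap_reduce \<phi> =
     (case (ratfun_reduce (fst \<phi>), ratfun_reduce (snd \<phi>)) of
        (Some f, Some g) \<Rightarrow> Some (f, g)
      | _ \<Rightarrow> None)"

section \<open>Almost good reduction\<close>

text \<open>
  The reduction of the image of \<open>(x, y)\<close> under \<open>\<psi>\<close> is the image of the reduced point under the
  reduced map, all of these being defined. The values of the reduced map are in the affine plane.
\<close>

definition commutes_with_reduction_at ::
    "'p::prime_card padic ratmap \<Rightarrow> 'p padic \<Rightarrow> 'p padic \<Rightarrow> bool" where
  "commutes_with_reduction_at \<psi> x y \<longleftrightarrow>
     (\<exists>\<psi>' u v x' y' u' v'.
        ratmap_value id \<psi> (x, y) = Some (u, v) \<and>
        ratmap_reduce \<psi> = Some \<psi>' \<and>
        padic_reduce x = Finite x' \<and> padic_reduce y = Finite y' \<and>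
        ratmap_value id \<psi>' (x', y') = Some (u', v') \<and>
        padic_reduce u = Finite u' \<and> padic_reduce v = Finite v')"

definition almost_good_reduction ::
    "(int \<Rightarrow> 'p::prime_card padic ratmap) \<Rightarrow> (int \<Rightarrow> ('p padic \<times> 'p padic) set) \<Rightarrow> bool" where
  "almost_good_reduction \<phi> D \<longleftrightarrow>
     (\<forall>n. D n \<subseteq> (padic_ints \<times> padic_ints) \<inter> {pt. ratmap_value id (\<phi> n) pt \<noteq> None}) \<and>
     (\<forall>n x y. (x, y) \<in> D n \<longrightarrow>
        (\<exists>m \<psi>. m > 0 \<and> ratmap_iter \<phi> n m = Some \<psi> \<and> commutes_with_reduction_at \<psi> x y))"

definition hietarinta_viallet :: "'a::field \<Rightarrow> 'a ratmap" where
  "hietarinta_viallet a = (rat_X + rat_const a / rat_X\<^sup>2 - rat_Y, rat_X)"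

end

theory Submission
  imports Defs
begin

text \<open>
  If a rational function is a fraction of polynomials over $\mathbf{Z}_p$ whose denominator does not
  vanish modulo $p$ at the reduced point, then that fraction is a minimal form, and evaluation there
  commutes with reduction. For $\tilde x \neq 0$ this applies to one step of the map. For
  $\tilde x = 0$ the singularity is confined: the first iterates are $A/x^2$, $B/(x^2A^2)$ and
  $xC/(A^2B^2)$ with $A$, $B$, $C$ congruent to $a$, $a^3$, $-a^8$ modulo $x$, and in the fourth one
  the poles along $x = 0$ cancel, leaving the denominator $A^2B^2C^2$.
\<close>

section \<open>Evaluation of polynomials in two variables, and one step of the map\<close>

lemma poly2_add:
  assumes "comm_ring_hom h"
  shows "poly2 h (P + Q) pt = poly2 h P pt + poly2 h Q pt"
proof -
  interpret comm_ring_hom h by (rule assms)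
  interpret m: map_poly_comm_ring_hom h ..
  interpret mm: map_poly_comm_ring_hom "map_poly h" ..
  show ?thesis by (cases pt) (simp add: poly2_def mm.hom_add)
qed

text \<open>Makes evaluation at a residue point available as a ring homomorphism, so that polynomial
  formulas such as those in \<open>hom_hv\<close> can be pushed through it.\<close>

lemma poly2_comm_ring_hom:
  assumes "comm_ring_hom h"
  shows "comm_ring_hom (\<lambda>P. poly2 h P pt)"
proof -
  interpret comm_ring_hom h by (rule assms)
  show ?thesis
    by unfold_locales (simp_all add: poly2_add poly2_mult assms, cases pt, simp add: poly2_def one_pCons)
qed

lemma map_poly_id_eq_id: "map_poly id = id"
  by (rule ext) simp

lemma poly2_map_poly [simp]: "poly2 id (map_poly (map_poly h) P) pt = poly2 h P pt"
  by (simp add: poly2_def map_poly_id_eq_id)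

lemma comm_ring_hom_id: "comm_ring_hom id"
  by unfold_locales auto

text \<open>A single value computed in Z_p thereby determines two others: its image under
  \<open>of_padic_int\<close> is the value over Q_p, and its image under
  \<open>padic_residue\<close> is the value over F_p.\<close>

lemma hom_poly2:
  assumes "comm_ring_hom h"
  shows "h (poly2 id P (u, v)) = poly2 h P (h u, h v)"
proof -
  interpret comm_ring_hom h by (rule assms)
  interpret m: map_poly_comm_ring_hom h ..
  have "map_poly h [:v:] = [:h v:]" by (simp add: map_poly_pCons_hom)
  then show ?thesis
    by (simp add: poly2_def map_poly_id_eq_id flip: poly_map_poly m.poly_map_poly)
qed

lemma rat_const_hom: "comm_ring_hom rat_const"
  by unfold_locales (simp_all add: rat_const_def Zero_fract_def One_fract_def one_pCons)

lemma rat_X_neq_0 [simp]: "rat_X \<noteq> 0"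
  by (simp add: rat_X_def Zero_fract_def eq_fract)

lemma rat_value_rat_X:
  assumes "comm_ring_hom h"
  shows "rat_value h rat_X (u, v) = Some u"
proof -
  interpret comm_ring_hom h by (rule assms)
  show ?thesis
    by (subst rat_value_eq[OF assms rat_X_def]) (simp_all add: poly2_def one_pCons)
qed

text \<open>The homomorphism is kept general to cover two uses: \<open>id\<close> gives values at
  points, which settles the domain condition, and \<open>rat_const\<close> gives values at points of
  the function field, which is composition.\<close>

lemma ratmap_value_hietarinta_viallet:
  assumes h: "comm_ring_hom h" and u: "u \<noteq> 0"
  shows "ratmap_value h (hietarinta_viallet a) (u, v) = Some (u + h a / u\<^sup>2 - v, u)"
proof -
  interpret comm_ring_hom h by (rule h)
  \<comment> \<open>The inner variable is x and the outer one y, so this is the fraction with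
    numerator a + x^3 - x^2 y and denominator x^2.\<close>
  let ?P = "[:[:a, 0, 0, 1:], [:0, 0, -1:]:]" and ?Q = "[:[:0, 0, 1:]:]"
  have "rat_X + rat_const a / rat_X\<^sup>2 - rat_Y = Fract ?P ?Q"
    by (simp add: rat_X_def rat_const_def rat_Y_def power2_eq_square eq_fract one_pCons)
  moreover have Q: "poly2 h ?Q (u, v) = u\<^sup>2"
    by (simp add: poly2_def power2_eq_square)
  moreover have "poly2 h ?P (u, v) = h a + u ^ 3 - u\<^sup>2 * v"
    by (simp add: poly2_def power2_eq_square power3_eq_cube hom_uminus algebra_simps)
  ultimately have "rat_value h (rat_X + rat_const a / rat_X\<^sup>2 - rat_Y) (u, v)
      = Some ((h a + u ^ 3 - u\<^sup>2 * v) / u\<^sup>2)"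
    using u rat_value_eq[OF h, of _ ?P ?Q "(u, v)"] by simp
  also have "(h a + u ^ 3 - u\<^sup>2 * v) / u\<^sup>2 = u + h a / u\<^sup>2 - v"
    using u by (simp add: field_simps power2_eq_square power3_eq_cube)
  finally show ?thesis
    by (simp add: ratmap_value_def hietarinta_viallet_def rat_value_rat_X[OF h])
qed

lemmas ratmap_comp_hietarinta_viallet =
  ratmap_value_hietarinta_viallet[OF rat_const_hom, folded ratmap_comp_def]

section \<open>Units of Z_p and elements of norm 1\<close>

lemma padic_residue_neq_0_iff_unit:
  fixes z :: "'p::prime_card padic_int"
  shows "padic_residue z \<noteq> 0 \<longleftrightarrow> z dvd 1"
proof
  assume "padic_residue z \<noteq> 0"
  then have "padic_coord z 1 \<noteq> 0"
    using padic_pow_dvd_iff[of 1 z] by (simp add: padic_residue_eq_0_iff)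
  then show "z dvd 1" by (rule padic_int_unitI)
next
  interpret comm_ring_hom "padic_residue :: 'p padic_int \<Rightarrow> _" by (rule padic_residue_hom)
  assume "z dvd 1"
  then obtain w where "z * w = 1" by (metis dvd_def)
  then have "padic_residue z * padic_residue w = 1" by (metis hom_mult hom_one)
  then show "padic_residue z \<noteq> 0" by auto
qed

text \<open>Norm 1 forces integrality and then valuation 0, so the coordinate of index 1 is nonzero.
  The nonzero residue is the form in which the hypothesis on the parameter enters the main
  argument.\<close>

lemma padic_norm_eq_1E:
  fixes a :: "'p::prime_card padic"
  assumes "padic_norm a = 1"
  obtains c where "a = of_padic_int c" "padic_residue c \<noteq> 0"
proof -
  have "a \<in> padic_ints" using assms by (simp add: padic_ints_iff_norm_le_1)
  then obtain c where c: "a = Fract c 1" by (auto simp: padic_ints_def of_padic_int_def)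
  have "a \<noteq> 0" using assms by (auto simp: padic_norm_def)
  with c have "c \<noteq> 0" by (auto simp: fract_collapse)
  have p1: "real CARD('p) > 1" using pr_gt_1[where 'p='p] by simp
  have "padic_int_val (1 :: 'p padic_int) = 0"
    using pr_gt_1[where 'p='p] by (intro padic_int_val_eqI) auto
  then have "real CARD('p) powi (- int (padic_int_val c)) = 1"
    using padic_norm_Fract[OF \<open>c \<noteq> 0\<close>, of 1] assms c by simp
  then have "real CARD('p) ^ padic_int_val c = 1"
    by (simp add: power_int_minus)
  then have "padic_int_val c = 0"
    using p1 by (metis less_irrefl one_less_power gr0I)
  then have "padic_coord c 1 \<noteq> 0"
    using padic_coord_val(2)[OF \<open>c \<noteq> 0\<close>] by simp
  then have "padic_residue c \<noteq> 0"
    using padic_int_unitI padic_residue_neq_0_iff_unit by blast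
  with c that show thesis by (simp add: of_padic_int_def)
qed

section \<open>Quotients of integral polynomials and their reduction\<close>

definition integral_ratfun :: "'p::prime_card padic_int poly poly \<Rightarrow> 'p padic ratfun" where
  "integral_ratfun P = Fract (map_poly (map_poly of_padic_int) P) 1"

lemma integral_ratfun_hom:
  "inj_comm_ring_hom (integral_ratfun :: 'p::prime_card padic_int poly poly \<Rightarrow> _)"
proof -
  interpret inj_comm_ring_hom of_padic_int by (rule of_padic_int_hom)
  interpret m: map_poly_inj_comm_ring_hom of_padic_int ..
  interpret mm: map_poly_inj_comm_ring_hom "map_poly of_padic_int" ..
  interpret comm_ring_hom "integral_ratfun :: 'p::prime_card padic_int poly poly \<Rightarrow> _"
    by unfold_locales (auto simp: integral_ratfun_def mm.hom_add mm.hom_mult fract_collapse)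
  show "inj_comm_ring_hom (integral_ratfun :: 'p padic_int poly poly \<Rightarrow> _)"
    by unfold_locales (auto simp: integral_ratfun_def fract_expand eq_fract)
qed

lemma integral_ratfun_divide:
  assumes "Q \<noteq> 0"
  shows "integral_ratfun P / integral_ratfun Q
    = Fract (map_poly (map_poly of_padic_int) P) (map_poly (map_poly of_padic_int) Q)"
  by (simp add: integral_ratfun_def)

lemma integral_ratfun_simps [simp]:
  "integral_ratfun [:[:0, 1:]:] = rat_X"
  "integral_ratfun [:0, 1:] = rat_Y"
  "integral_ratfun [:[:c:]:] = rat_const (of_padic_int c)"
proof -
  interpret inj_comm_ring_hom of_padic_int by (rule of_padic_int_hom)
  interpret m: map_poly_inj_comm_ring_hom of_padic_int ..
  show "integral_ratfun [:[:0, 1:]:] = rat_X" "integral_ratfun [:0, 1:] = rat_Y"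
    "integral_ratfun [:[:c:]:] = rat_const (of_padic_int c)"
    by (simp_all add: integral_ratfun_def rat_X_def rat_Y_def rat_const_def map_poly_pCons_hom m.map_poly_pCons_hom)
qed

text \<open>The denominator takes a unit value at (x, y), so the quotient of values already lies in
  Z_p. The fraction need not be in lowest terms, since reduction and value do not depend on the
  chosen representation.\<close>

lemma ratfun_commutes_with_reduction:
  fixes P Q :: "'p::prime_card padic_int poly poly"
  assumes Q: "poly2 padic_residue Q (padic_residue x, padic_residue y) \<noteq> 0"
  defines "f \<equiv> integral_ratfun P / integral_ratfun Q"
  obtains f' z where "ratfun_reduce f = Some f'"
    "rat_value id f (of_padic_int x, of_padic_int y) = Some (of_padic_int z)"
    "rat_value id f' (padic_residue x, padic_residue y) = Some (padic_residue z)"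
proof -
  let ?e = "map_poly (map_poly of_padic_int)"
  interpret e: inj_comm_ring_hom "of_padic_int :: 'p padic_int \<Rightarrow> _" by (rule of_padic_int_hom)
  interpret r: comm_ring_hom "padic_residue :: 'p padic_int \<Rightarrow> _" by (rule padic_residue_hom)
  have e: "comm_ring_hom (of_padic_int :: 'p padic_int \<Rightarrow> _)" ..
  have rQ: "residue_poly2 Q \<noteq> 0"
    using Q by (metis poly2_0 poly2_map_poly)
  then have "Q \<noteq> 0" by auto
  then have f: "f = Fract (?e P) (?e Q)" unfolding f_def by (rule integral_ratfun_divide)
  obtain i j where "coeff (coeff (residue_poly2 Q) j) i \<noteq> 0"
    using rQ by (metis leading_coeff_0_iff)
  then have "padic_residue (coeff (coeff Q j) i) \<noteq> 0"
    by (simp add: coeff_map_poly)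
  \<comment> \<open>One unit coefficient in the denominator is all that minimality asks for,
    whatever the numerator is.\<close>
  then have "coeff (coeff Q j) i dvd 1" by (simp add: padic_residue_neq_0_iff_unit)
  then have "minimal_form f P Q"
    using f \<open>Q \<noteq> 0\<close> unfolding minimal_form_def by blast
  then have red: "ratfun_reduce f = Some (Fract (residue_poly2 P) (residue_poly2 Q))"
    using rQ by (rule ratfun_reduce_eq)
  define s t where "s = poly2 id P (x, y)" and "t = poly2 id Q (x, y)"
  have rs: "poly2 padic_residue P (padic_residue x, padic_residue y) = padic_residue s"
    and rt: "poly2 padic_residue Q (padic_residue x, padic_residue y) = padic_residue t"
    by (simp_all add: s_def t_def hom_poly2[OF padic_residue_hom])
  have "t dvd 1" using Q rt by (simp add: padic_residue_neq_0_iff_unit)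
  \<comment> \<open>With the inverse \<open>w\<close> of \<open>t\<close> in Z_p, the quotients over
    Q_p and over F_p are both images of the one p-adic integer \<open>s * w\<close>, the witness for
    \<open>z\<close>.\<close>
  then obtain w where w: "t * w = 1" by (metis dvd_def)
  have "of_padic_int t * of_padic_int w = 1" using w by (metis e.hom_mult e.hom_one)
  then have t0: "of_padic_int t \<noteq> 0" and st: "of_padic_int s / of_padic_int t = of_padic_int (s * w)"
    by (auto simp: e.hom_mult divide_eq_eq algebra_simps)
  have "padic_residue t * padic_residue w = 1" using w by (metis r.hom_mult r.hom_one)
  then have "padic_residue s = padic_residue s * padic_residue w * padic_residue t"
    by (simp add: mult.assoc mult.commute[of "padic_residue w"])
  then have rst: "padic_residue s / padic_residue t = padic_residue (s * w)"
    using Q rt by (simp add: r.hom_mult nonzero_divide_eq_eq)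
  show thesis
  proof (rule that[OF red])
    show "rat_value id f (of_padic_int x, of_padic_int y) = Some (of_padic_int (s * w))"
      using t0 st by (subst rat_value_eq[OF comm_ring_hom_id f])
        (simp_all add: s_def t_def flip: hom_poly2[OF e])
    show "rat_value id (Fract (residue_poly2 P) (residue_poly2 Q)) (padic_residue x, padic_residue y)
        = Some (padic_residue (s * w))"
      using Q rst by (subst rat_value_eq[OF comm_ring_hom_id refl]) (simp_all add: rs rt)
  qed
qed

lemma commutes_with_reduction_at_integral:
  fixes x y :: "'p::prime_card padic_int"
  assumes "poly2 padic_residue Q (padic_residue x, padic_residue y) \<noteq> 0"
    and "poly2 padic_residue Q' (padic_residue x, padic_residue y) \<noteq> 0"
  shows "commutes_with_reduction_at
    (integral_ratfun P / integral_ratfun Q, integral_ratfun P' / integral_ratfun Q')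
    (of_padic_int x) (of_padic_int y)"
proof -
  obtain f z where "ratfun_reduce (integral_ratfun P / integral_ratfun Q) = Some f"
    "rat_value id (integral_ratfun P / integral_ratfun Q) (of_padic_int x, of_padic_int y) = Some (of_padic_int z)"
    "rat_value id f (padic_residue x, padic_residue y) = Some (padic_residue z)"
    by (rule ratfun_commutes_with_reduction[OF assms(1)])
  moreover obtain f' z' where "ratfun_reduce (integral_ratfun P' / integral_ratfun Q') = Some f'"
    "rat_value id (integral_ratfun P' / integral_ratfun Q') (of_padic_int x, of_padic_int y) = Some (of_padic_int z')"
    "rat_value id f' (padic_residue x, padic_residue y) = Some (padic_residue z')"
    by (rule ratfun_commutes_with_reduction[OF assms(2)])
  ultimately show ?thesis
    unfolding commutes_with_reduction_at_def ratmap_value_def ratmap_reduce_def by simp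
qed

section \<open>Singularity confinement: explicit iterates\<close>

definition hv_A :: "'a::comm_ring_1 \<Rightarrow> 'a \<Rightarrow> 'a \<Rightarrow> 'a" where
  "hv_A a x y = a + x ^ 3 - x\<^sup>2 * y"

definition hv_B :: "'a::comm_ring_1 \<Rightarrow> 'a \<Rightarrow> 'a \<Rightarrow> 'a" where
  "hv_B a x y = (a - x\<^sup>2 * y) * (hv_A a x y)\<^sup>2 + a * x ^ 6"

definition hv_C :: "'a::comm_ring_1 \<Rightarrow> 'a \<Rightarrow> 'a \<Rightarrow> 'a" where
  "hv_C a x y = a * x ^ 3 * ((hv_B a x y)\<^sup>2 + hv_A a x y ^ 6) - (hv_A a x y)\<^sup>2 * (hv_B a x y)\<^sup>2"

text \<open>The cofactor of x^2 in a A^6 B^3 - C^2, written out so that no division is performed in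
  the ring. With this \<open>D\<close> one has C = x^3 D - A^2 B^2.\<close>

definition hv_E :: "'a::comm_ring_1 \<Rightarrow> 'a \<Rightarrow> 'a \<Rightarrow> 'a" where
  "hv_E a x y = (let A = hv_A a x y; B = hv_B a x y; D = a * (B\<^sup>2 + A ^ 6) in
     A ^ 4 * B ^ 3 * (y * A\<^sup>2 - a * x ^ 4) + 2 * x * A\<^sup>2 * B\<^sup>2 * D - x ^ 4 * D\<^sup>2)"

text \<open>Modulo x^2, C^2 is A^4 B^4 and B is a A^2, so the left side is A^4 B^3 (a A^2 - B),
  which vanishes there. This is the cancellation that removes the pole in the fourth
  iterate.\<close>

lemma hv_confinement:
  "a * hv_A a x y ^ 6 * hv_B a x y ^ 3 - (hv_C a x y)\<^sup>2 = x\<^sup>2 * hv_E a x y"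
proof -
  define A where "A = hv_A a x y"
  define B where "B = hv_B a x y"
  define D where "D = a * (B\<^sup>2 + A ^ 6)"
  have C: "hv_C a x y = x ^ 3 * D - A\<^sup>2 * B\<^sup>2"
    by (simp add: hv_C_def A_def B_def D_def algebra_simps)
  have E: "hv_E a x y = A ^ 4 * B ^ 3 * (y * A\<^sup>2 - a * x ^ 4) + 2 * x * A\<^sup>2 * B\<^sup>2 * D - x ^ 4 * D\<^sup>2"
    by (simp add: hv_E_def A_def B_def D_def Let_def)
  have "B = (a - x\<^sup>2 * y) * A\<^sup>2 + a * x ^ 6"
    by (simp add: B_def hv_B_def A_def)
  then have AB: "a * A\<^sup>2 - B = x\<^sup>2 * (y * A\<^sup>2 - a * x ^ 4)"
    by (simp add: algebra_simps numeral_eq_Suc)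
  have "a * A ^ 6 * B ^ 3 - (x ^ 3 * D - A\<^sup>2 * B\<^sup>2)\<^sup>2
      = A ^ 4 * B ^ 3 * (a * A\<^sup>2 - B) + x\<^sup>2 * (2 * x * A\<^sup>2 * B\<^sup>2 * D - x ^ 4 * D\<^sup>2)"
    by (simp add: algebra_simps numeral_eq_Suc)
  also have "\<dots> = x\<^sup>2 * hv_E a x y"
    unfolding AB E by (simp add: algebra_simps numeral_eq_Suc)
  finally show ?thesis unfolding C A_def B_def .
qed

text \<open>Only first coordinates need computing, since each second coordinate is the preceding
  first one. Every step clears denominators; the third and fourth also cancel a factor x^2.\<close>

lemma hv_iterates:
  fixes a x y :: "'a::field"
  defines "A \<equiv> hv_A a x y" and "B \<equiv> hv_B a x y" and "C \<equiv> hv_C a x y" and "E \<equiv> hv_E a x y"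
  assumes nz: "x \<noteq> 0" "A \<noteq> 0" "B \<noteq> 0" "C \<noteq> 0"
  shows "x + a / x\<^sup>2 - y = A / x\<^sup>2"
    and "A / x\<^sup>2 + a / (A / x\<^sup>2)\<^sup>2 - x = B / (x\<^sup>2 * A\<^sup>2)"
    and "B / (x\<^sup>2 * A\<^sup>2) + a / (B / (x\<^sup>2 * A\<^sup>2))\<^sup>2 - A / x\<^sup>2 = x * C / (A\<^sup>2 * B\<^sup>2)"
    and "x * C / (A\<^sup>2 * B\<^sup>2) + a / (x * C / (A\<^sup>2 * B\<^sup>2))\<^sup>2 - B / (x\<^sup>2 * A\<^sup>2)
       = (x * C ^ 3 + B ^ 3 * E) / (A\<^sup>2 * B\<^sup>2 * C\<^sup>2)"
proof -
  have A: "A = a + x ^ 3 - x\<^sup>2 * y"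
    and B: "B = (a - x\<^sup>2 * y) * A\<^sup>2 + a * x ^ 6"
    and C: "C = a * x ^ 3 * (B\<^sup>2 + A ^ 6) - A\<^sup>2 * B\<^sup>2"
    by (simp_all add: A_def B_def C_def hv_A_def hv_B_def hv_C_def)
  show "x + a / x\<^sup>2 - y = A / x\<^sup>2"
    using nz(1) unfolding A by (simp add: field_simps power2_eq_square power3_eq_cube)
  have "A / x\<^sup>2 + a / (A / x\<^sup>2)\<^sup>2 - x = (A ^ 3 + a * x ^ 6 - x ^ 3 * A\<^sup>2) / (x\<^sup>2 * A\<^sup>2)"
    using nz by (simp add: divide_simps) (simp add: algebra_simps numeral_eq_Suc)
  \<comment> \<open>Replacing a - x^2 y by A - x^3 eliminates y from B.\<close>
  also have B': "A ^ 3 + a * x ^ 6 - x ^ 3 * A\<^sup>2 = B"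
  proof -
    have "a - x\<^sup>2 * y = A - x ^ 3" by (simp add: A)
    then have "B = (A - x ^ 3) * A\<^sup>2 + a * x ^ 6" by (simp only: B)
    then show ?thesis by (simp add: algebra_simps numeral_eq_Suc)
  qed
  finally show "A / x\<^sup>2 + a / (A / x\<^sup>2)\<^sup>2 - x = B / (x\<^sup>2 * A\<^sup>2)" .
  have "B / (x\<^sup>2 * A\<^sup>2) + a / (B / (x\<^sup>2 * A\<^sup>2))\<^sup>2 - A / x\<^sup>2
      = (B ^ 3 + a * x ^ 6 * A ^ 6 - A ^ 3 * B\<^sup>2) / (x\<^sup>2 * A\<^sup>2 * B\<^sup>2)"
    using nz by (simp add: divide_simps) (simp add: algebra_simps numeral_eq_Suc)
  also have "B ^ 3 + a * x ^ 6 * A ^ 6 - A ^ 3 * B\<^sup>2 = x ^ 3 * C"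
  proof -
    \<comment> \<open>This difference is divisible by x^3, whence the factor x^3 of the numerator:
      two powers cancel the pole and one survives in x C.\<close>
    have "B - A ^ 3 = a * x ^ 6 - x ^ 3 * A\<^sup>2" by (simp flip: B')
    then have "B\<^sup>2 * (B - A ^ 3) = B\<^sup>2 * (a * x ^ 6 - x ^ 3 * A\<^sup>2)" by simp
    then show ?thesis unfolding C by (simp add: algebra_simps numeral_eq_Suc)
  qed
  also have "x ^ 3 * C / (x\<^sup>2 * A\<^sup>2 * B\<^sup>2) = x * C / (A\<^sup>2 * B\<^sup>2)"
    using nz by (simp add: power2_eq_square power3_eq_cube)
  finally show "B / (x\<^sup>2 * A\<^sup>2) + a / (B / (x\<^sup>2 * A\<^sup>2))\<^sup>2 - A / x\<^sup>2 = x * C / (A\<^sup>2 * B\<^sup>2)" .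
  have "x * C / (A\<^sup>2 * B\<^sup>2) + a / (x * C / (A\<^sup>2 * B\<^sup>2))\<^sup>2 - B / (x\<^sup>2 * A\<^sup>2)
      = (x ^ 3 * C ^ 3 + B ^ 3 * (a * A ^ 6 * B ^ 3 - C\<^sup>2)) / (x\<^sup>2 * (A\<^sup>2 * B\<^sup>2 * C\<^sup>2))"
    using nz by (simp add: divide_simps) (simp add: algebra_simps numeral_eq_Suc)
  \<comment> \<open>Now both summands of the numerator carry x^2, which cancels against the
    denominator.\<close>
  also have "a * A ^ 6 * B ^ 3 - C\<^sup>2 = x\<^sup>2 * E"
    unfolding A_def B_def C_def E_def by (rule hv_confinement)
  also have "x ^ 3 * C ^ 3 + B ^ 3 * (x\<^sup>2 * E) = x\<^sup>2 * (x * C ^ 3 + B ^ 3 * E)"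
    by (simp add: algebra_simps numeral_eq_Suc)
  also have "\<dots> / (x\<^sup>2 * (A\<^sup>2 * B\<^sup>2 * C\<^sup>2)) = (x * C ^ 3 + B ^ 3 * E) / (A\<^sup>2 * B\<^sup>2 * C\<^sup>2)"
    using nz(1) by simp
  finally show "x * C / (A\<^sup>2 * B\<^sup>2) + a / (x * C / (A\<^sup>2 * B\<^sup>2))\<^sup>2 - B / (x\<^sup>2 * A\<^sup>2)
       = (x * C ^ 3 + B ^ 3 * E) / (A\<^sup>2 * B\<^sup>2 * C\<^sup>2)" .
qed

text \<open>All four are polynomials with integer coefficients. The same formulas can therefore be
  read over Z_p[x][y], in the function field and in F_p, and be transported between them.\<close>

lemma hom_hv:
  assumes "comm_ring_hom h"
  shows "h (hv_A a x y) = hv_A (h a) (h x) (h y)"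
    and "h (hv_B a x y) = hv_B (h a) (h x) (h y)"
    and "h (hv_C a x y) = hv_C (h a) (h x) (h y)"
    and "h (hv_E a x y) = hv_E (h a) (h x) (h y)"
proof -
  interpret comm_ring_hom h by (rule assms)
  have two: "h 2 = 2" by (metis hom_add hom_one one_add_one)
  note hom = hom_add hom_mult hom_minus hom_power two
  show A: "h (hv_A a x y) = hv_A (h a) (h x) (h y)"
    by (simp add: hv_A_def hom)
  show B: "h (hv_B a x y) = hv_B (h a) (h x) (h y)"
    by (simp add: hv_B_def hom A)
  show "h (hv_C a x y) = hv_C (h a) (h x) (h y)"
    by (simp add: hv_C_def hom A B)
  show "h (hv_E a x y) = hv_E (h a) (h x) (h y)"
    by (simp add: hv_E_def hom A B Let_def)
qed

lemma hv_at_0: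
  "hv_A a 0 y = a" "hv_B a 0 y = a ^ 3" "hv_C a 0 y = - (a ^ 8)"
  by (simp_all add: hv_A_def hv_B_def hv_C_def algebra_simps numeral_eq_Suc)

section \<open>Reduction after one step or after four\<close>

theorem proposition4p1:
  fixes a :: "'p::prime_card padic"
  assumes "padic_norm a = 1"
  shows "almost_good_reduction (\<lambda>n. hietarinta_viallet a)
           (\<lambda>n. {(x, y). x \<in> padic_ints \<and> y \<in> padic_ints \<and> x \<noteq> 0})"
proof -
  let ?D = "{(x, y). x \<in> padic_ints \<and> y \<in> padic_ints \<and> x \<noteq> 0} :: ('p padic \<times> 'p padic) set"
  obtain c where a: "a = of_padic_int c" and c: "padic_residue c \<noteq> 0"
    using padic_norm_eq_1E[OF assms] by blast
  have dom: "?D \<subseteq> (padic_ints \<times> padic_ints) \<inter> {pt. ratmap_value id (hietarinta_viallet a) pt \<noteq> None}"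
    by (auto simp: ratmap_value_hietarinta_viallet[OF comm_ring_hom_id])
  \<comment> \<open>Points of the domain have coordinates in the range of
    \<open>of_padic_int\<close>, so it suffices to treat images of p-adic integers.\<close>
  have "\<exists>m \<psi>. m > 0 \<and> ratmap_iter (\<lambda>n. hietarinta_viallet a) n m = Some \<psi> \<and>
      commutes_with_reduction_at \<psi> (of_padic_int x) (of_padic_int y)" for n and x y :: "'p padic_int"
  proof -
    let ?pt = "(padic_residue x, padic_residue y)"
    \<comment> \<open>The parameter and the two variables as integral polynomials:
      \<open>integral_ratfun\<close> sends them to the function field, and evaluation at
      \<open>?pt\<close> sends them to F_p.\<close>
    define \<alpha> \<xi> \<eta> :: "'p padic_int poly poly"
      where "\<alpha> = [:[:c:]:]" and "\<xi> = [:[:0, 1:]:]" and "\<eta> = [:0, 1:]"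
    interpret I: inj_comm_ring_hom "integral_ratfun :: 'p padic_int poly poly \<Rightarrow> _"
      by (rule integral_ratfun_hom)
    have I: "comm_ring_hom (integral_ratfun :: 'p padic_int poly poly \<Rightarrow> _)" ..
    have I_simps: "integral_ratfun \<alpha> = rat_const a" "integral_ratfun \<xi> = rat_X" "integral_ratfun \<eta> = rat_Y"
      by (simp_all add: \<alpha>_def \<xi>_def \<eta>_def a)
    have V: "comm_ring_hom (\<lambda>P. poly2 padic_residue P ?pt)"
      by (rule poly2_comm_ring_hom[OF padic_residue_hom])
    interpret V: comm_ring_hom "\<lambda>P. poly2 padic_residue P ?pt" by (rule V)
    interpret r: comm_ring_hom "padic_residue :: 'p padic_int \<Rightarrow> _" by (rule padic_residue_hom)
    interpret rm: map_poly_comm_ring_hom "padic_residue :: 'p padic_int \<Rightarrow> _" ..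
    have V_simps: "poly2 padic_residue \<alpha> ?pt = padic_residue c"
      "poly2 padic_residue \<xi> ?pt = padic_residue x" "poly2 padic_residue \<eta> ?pt = padic_residue y"
      by (simp_all add: \<alpha>_def \<xi>_def \<eta>_def poly2_def r.map_poly_pCons_hom rm.map_poly_pCons_hom)
    show ?thesis
    proof (cases "padic_residue x = 0")
      case False
      let ?\<psi> = "(rat_X + rat_const a / rat_X\<^sup>2 - rat_Y, rat_X)"
      \<comment> \<open>The denominators are \<xi>^2 and 1; the first takes the square of the
        nonzero residue of \<open>x\<close> as its value at \<open>?pt\<close>.\<close>
      have "?\<psi> = (integral_ratfun (hv_A \<alpha> \<xi> \<eta>) / integral_ratfun (\<xi>\<^sup>2), integral_ratfun \<xi> / integral_ratfun 1)"
        unfolding hom_hv[OF I] I_simps I.hom_power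
        unfolding hv_A_def by (simp add: field_simps power2_eq_square power3_eq_cube)
      moreover have "commutes_with_reduction_at \<dots> (of_padic_int x) (of_padic_int y)"
        by (rule commutes_with_reduction_at_integral) (simp_all add: V.hom_power V_simps False)
      moreover have "ratmap_iter (\<lambda>n. hietarinta_viallet a) n 1 = Some ?\<psi>"
        by (simp add: ratmap_comp_hietarinta_viallet)
      ultimately show ?thesis by (intro exI[of _ 1]) simp
    next
      case True
      define A B C E where "A = hv_A \<alpha> \<xi> \<eta>" and "B = hv_B \<alpha> \<xi> \<eta>"
        and "C = hv_C \<alpha> \<xi> \<eta>" and "E = hv_E \<alpha> \<xi> \<eta>"
      \<comment> \<open>At residue x = 0 the three values are, up to sign, the powers 1, 3 and 8 of
        the nonzero residue of \<open>c\<close>.\<close>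
      have V_nz: "poly2 padic_residue A ?pt \<noteq> 0" "poly2 padic_residue B ?pt \<noteq> 0" "poly2 padic_residue C ?pt \<noteq> 0"
        unfolding A_def B_def C_def hom_hv[OF V] V_simps unfolding True hv_at_0 using c by simp_all
      \<comment> \<open>A nonzero value at one residue point makes the polynomial itself nonzero,
        which permits the divisions in the function field.\<close>
      then have "A \<noteq> 0" "B \<noteq> 0" "C \<noteq> 0" by (metis poly2_0)+
      let ?A = "integral_ratfun A" and ?B = "integral_ratfun B"
        and ?C = "integral_ratfun C" and ?E = "integral_ratfun E"
      have nz: "?A \<noteq> 0" "?B \<noteq> 0" "?C \<noteq> 0"
        using \<open>A \<noteq> 0\<close> \<open>B \<noteq> 0\<close> \<open>C \<noteq> 0\<close> by simp_all
      have "hv_A (rat_const a) rat_X rat_Y = ?A" "hv_B (rat_const a) rat_X rat_Y = ?B"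
        "hv_C (rat_const a) rat_X rat_Y = ?C" "hv_E (rat_const a) rat_X rat_Y = ?E"
        by (simp_all add: A_def B_def C_def E_def hom_hv[OF I] I_simps)
      \<comment> \<open>Taken at the generic point, the field identities describe the composed
        rational maps themselves.\<close>
      note it = hv_iterates[of rat_X "rat_const a" rat_Y, unfolded this, OF rat_X_neq_0 nz]
      have steps:
        "ratmap_comp (hietarinta_viallet a) (rat_X, rat_Y) = Some (?A / rat_X\<^sup>2, rat_X)"
        "ratmap_comp (hietarinta_viallet a) (?A / rat_X\<^sup>2, rat_X)
          = Some (?B / (rat_X\<^sup>2 * ?A\<^sup>2), ?A / rat_X\<^sup>2)"
        "ratmap_comp (hietarinta_viallet a) (?B / (rat_X\<^sup>2 * ?A\<^sup>2), ?A / rat_X\<^sup>2)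
          = Some (rat_X * ?C / (?A\<^sup>2 * ?B\<^sup>2), ?B / (rat_X\<^sup>2 * ?A\<^sup>2))"
        "ratmap_comp (hietarinta_viallet a) (rat_X * ?C / (?A\<^sup>2 * ?B\<^sup>2), ?B / (rat_X\<^sup>2 * ?A\<^sup>2))
          = Some ((rat_X * ?C ^ 3 + ?B ^ 3 * ?E) / (?A\<^sup>2 * ?B\<^sup>2 * ?C\<^sup>2), rat_X * ?C / (?A\<^sup>2 * ?B\<^sup>2))"
        by (subst ratmap_comp_hietarinta_viallet, use nz in simp, simp only: it)+
      \<comment> \<open>After three steps the second component still has x^2 in its denominator.
        After four, both denominators are products of powers of \<open>A\<close>, \<open>B\<close>
        and \<open>C\<close>, nonzero at \<open>?pt\<close>.\<close>
      let ?\<psi> = "(integral_ratfun (\<xi> * C ^ 3 + B ^ 3 * E) / integral_ratfun (A\<^sup>2 * B\<^sup>2 * C\<^sup>2),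
        integral_ratfun (\<xi> * C) / integral_ratfun (A\<^sup>2 * B\<^sup>2))"
      have four: "(4 :: nat) = Suc (Suc (Suc (Suc 0)))" by simp
      have "ratmap_iter (\<lambda>n. hietarinta_viallet a) n 4 = Some ?\<psi>"
        unfolding four
        by (simp add: steps I_simps I.hom_add I.hom_mult I.hom_power)
      moreover have "commutes_with_reduction_at ?\<psi> (of_padic_int x) (of_padic_int y)"
        by (rule commutes_with_reduction_at_integral) (simp_all add: V.hom_power V.hom_mult V_nz)
      ultimately show ?thesis by (intro exI[of _ 4]) simp
    qed
  qed
  then show ?thesis
    unfolding almost_good_reduction_def using dom by (auto simp: padic_ints_def)
qed

end
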